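(* Let $q$ be a prime power and let $G(V,E)$ be a finite directed or undirected graph. For any $q$-ary RDSS code for $G$ with distance $d$ and dimension $k$, $$k\ \le\ \min_{U\in\mathcal{I}(G)}\Big(|N(U)|+\log_q\mathcal{A}_q\big(|V|-|U\cup N(U)|,\,d\big)\Big),$$ where $\mathcal{A}_q(n,d)$ is the maximum size of a $q$-ary error-correcting code of length $n$ and distance $d$, and where $\mathcal{I}(G)$ is the set of all independent sets of $G$ if $G$ is undirected, and the set of vertex sets of all induced acyclic subgraphs of $G$ if $G$ is directed.
   Context: Write $V=\{1,\dots,n\}$. For $i\in V$, $N(i)=\{u\in V:(i,u)\in E\}$. For $U\subseteq V$, $N(U)$ is the set of all vertices $w\in V\setminus U$ such that $(u,w)\in E$ for some $u\in U$. For $X\in\mathbb{F}_q^n$ and $I\subseteq V$, $X_I$ denotes the projection onto the coordinates in $I$. An RDSS (recoverable distributed storage system) code for $G$ is a set $\mathcal{C}\subseteq\mathbb{F}_q^n$ for which there are deterministic functions $f_i:\mathbb{F}_q^{|N(i)|}\to\mathbb{F}_q$, $i=1,\dots,n$, with $X_i=f_i(X_{N(i)})$ for all $X\in\mathcal{C}$ and all $i$. Its dimension is $\log_q|\mathcal{C}|$ (codes are nonempty). It is an RDSS code with distance $d$ if the Hamming distance between any two distinct codewords is at least $d$. $\mathcal{A}_q(n,d)$ is the maximum cardinality of a subset of $\mathbb{F}_q^n$ in which any two distinct elements have Hamming distance at least $d$; a single-element set qualifies, so $\mathcal{A}_q(n,d)\ge1$ always (including $n=0$ and $n<d$). *)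

theory Defs
  imports
    Complex_Main
    "HOL-Library.FuncSet"
    "HOL-Algebra.Ring"
    "HOL-Number_Theory.Prime_Powers"
begin

section \<open>Directed and undirected graphs on \<open>{1..n}\<close>\<close>

text \<open>
  Both kinds of graph carry a set of ordered pairs; in an undirected graph the edge
  \<open>{u, v}\<close> is stored as both \<open>(u, v)\<close> and \<open>(v, u)\<close>. The flag is not determined by the
  edge set, since a directed graph may happen to have a symmetric one. Loops are not
  excluded: a vertex with a loop lies in no independent set and in no acyclic set.
\<close>

record dss_graph =
  num_verts :: nat
  edges :: "(nat \<times> nat) set"
  directed :: bool

definition vertices :: "dss_graph \<Rightarrow> nat set" where
  "vertices G = {1..num_verts G}"

definition wf_graph :: "dss_graph \<Rightarrow> bool" where
  "wf_graph G \<longleftrightarrow>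
     edges G \<subseteq> vertices G \<times> vertices G \<and> (\<not> directed G \<longrightarrow> sym (edges G))"

definition nbrs :: "dss_graph \<Rightarrow> nat \<Rightarrow> nat set" where
  "nbrs G i = {u \<in> vertices G. (i, u) \<in> edges G}"

definition set_nbrs :: "dss_graph \<Rightarrow> nat set \<Rightarrow> nat set" where
  "set_nbrs G U = {w \<in> vertices G - U. \<exists>u\<in>U. (u, w) \<in> edges G}"

definition independent_set :: "dss_graph \<Rightarrow> nat set \<Rightarrow> bool" where
  "independent_set G U \<longleftrightarrow>
     U \<subseteq> vertices G \<and> (\<forall>u\<in>U. \<forall>v\<in>U. (u, v) \<notin> edges G)"

text \<open>The edge set of the subgraph induced by \<open>U\<close> is \<open>edges G \<inter> U \<times> U\<close>.\<close>

definition induces_acyclic :: "dss_graph \<Rightarrow> nat set \<Rightarrow> bool" where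
  "induces_acyclic G U \<longleftrightarrow> U \<subseteq> vertices G \<and> acyclic (edges G \<inter> U \<times> U)"

definition admissible_sets :: "dss_graph \<Rightarrow> nat set set" where
  "admissible_sets G =
     (if directed G then {U. induces_acyclic G U} else {U. independent_set G U})"


section \<open>Codes over a finite field\<close>

text \<open>
  A vector with coordinates in \<open>I\<close> is an extensional function on \<open>I\<close>, so that the
  projection onto a set of coordinates is \<^const>\<open>restrict\<close>.
\<close>

definition vectors :: "('a, 'b) ring_scheme \<Rightarrow> nat set \<Rightarrow> (nat \<Rightarrow> 'a) set" where
  "vectors F I = I \<rightarrow>\<^sub>E carrier F"

definition hamming_dist :: "nat set \<Rightarrow> (nat \<Rightarrow> 'a) \<Rightarrow> (nat \<Rightarrow> 'a) \<Rightarrow> nat" where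
  "hamming_dist I x y = card {i \<in> I. x i \<noteq> y i}"

definition has_distance :: "nat set \<Rightarrow> (nat \<Rightarrow> 'a) set \<Rightarrow> nat \<Rightarrow> bool" where
  "has_distance I C d \<longleftrightarrow> (\<forall>x\<in>C. \<forall>y\<in>C. x \<noteq> y \<longrightarrow> d \<le> hamming_dist I x y)"

definition max_code_size :: "('a, 'b) ring_scheme \<Rightarrow> nat \<Rightarrow> nat \<Rightarrow> nat" where
  "max_code_size F m d =
     Max {card C | C. C \<subseteq> vectors F {1..m} \<and> has_distance {1..m} C d}"


section \<open>Recoverable distributed storage codes\<close>

definition rdss_code ::
    "('a, 'b) ring_scheme \<Rightarrow> dss_graph \<Rightarrow> (nat \<Rightarrow> 'a) set \<Rightarrow> bool" where
  "rdss_code F G C \<longleftrightarrow>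
     C \<noteq> {} \<and> C \<subseteq> vectors F (vertices G) \<and>
     (\<exists>f. (\<forall>i\<in>vertices G. f i \<in> vectors F (nbrs G i) \<rightarrow> carrier F) \<and>
          (\<forall>X\<in>C. \<forall>i\<in>vertices G. X i = f i (restrict X (nbrs G i))))"

definition code_dimension ::
    "('a, 'b) ring_scheme \<Rightarrow> (nat \<Rightarrow> 'a) set \<Rightarrow> real" where
  "code_dimension F C = log (card (carrier F)) (card C)"

end

theory Submission
  imports Defs
begin

text \<open>
  If two codewords agree on \<open>N(U)\<close>, they agree on \<open>U\<close>: every vertex of \<open>U\<close> where they
  differ has an out-neighbour in \<open>U\<close> where they differ, which is impossible in a finite
  acyclic graph. Hence the codewords with prescribed values on \<open>N(U)\<close> differ only outside
  \<open>U \<union> N(U)\<close>, so they form a code of distance \<open>d\<close> on the remaining coordinates; there are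
  at most \<open>q ^ |N(U)|\<close> choices of the prescribed values.
\<close>

lemma finite_vertices: "finite (vertices G)"
  by (simp add: vertices_def)

lemma set_nbrs_subset: "set_nbrs G U \<subseteq> vertices G"
  by (auto simp: set_nbrs_def)

lemma finite_vectors: "finite (carrier F) \<Longrightarrow> finite I \<Longrightarrow> finite (vectors F I)"
  by (simp add: vectors_def finite_PiE)

lemma card_vectors: "finite I \<Longrightarrow> card (vectors F I) = card (carrier F) ^ card I"
  by (simp add: vectors_def card_PiE)

lemma restrict_in_vectors:
  "x \<in> vectors F V \<Longrightarrow> I \<subseteq> V \<Longrightarrow> restrict x I \<in> vectors F I"
  by (auto simp: vectors_def)

text \<open>\<open>Max\<close> bounds the elements of a finite set only; here finiteness holds
  because every size is that of a subset of the finite set \<open>vectors F {1..m}\<close>.\<close>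

lemma card_le_max_code_size_interval:
  assumes "finite (carrier F)" "D \<subseteq> vectors F {1..m}" "has_distance {1..m} D d"
  shows "card D \<le> max_code_size F m d"
proof -
  let ?S = "{card C | C. C \<subseteq> vectors F {1..m} \<and> has_distance {1..m} C d}"
  have "?S \<subseteq> card ` Pow (vectors F {1..m})"
    by auto
  then have "finite ?S"
    using finite_vectors[OF assms(1)]
    by (meson finite_Pow_iff finite_atLeastAtMost finite_imageI finite_subset)
  then show ?thesis
    unfolding max_code_size_def using assms(2,3) by (intro Max_ge) auto
qed

text \<open>A single word is a code of every distance. Positivity lets the logarithm of the final
  product be split into a sum.\<close>

lemma max_code_size_pos:
  assumes "finite (carrier F)" "carrier F \<noteq> {}"
  shows "0 < max_code_size F m d"
proof -
  have "vectors F {1..m} \<noteq> {}"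
    using assms(2) by (simp add: vectors_def PiE_eq_empty_iff)
  then obtain x where "x \<in> vectors F {1..m}"
    by blast
  then have "card {x} \<le> max_code_size F m d"
    by (intro card_le_max_code_size_interval assms(1)) (auto simp: has_distance_def)
  then show ?thesis
    by simp
qed

text \<open>Relabelling coordinates along a bijection preserves Hamming distance, so the maximum
  defined on \<open>{1..m}\<close> also bounds codes on any coordinate set of size
  \<open>m\<close>.\<close>

lemma card_le_max_code_size:
  assumes "finite (carrier F)" "finite W" "D \<subseteq> vectors F W" "has_distance W D d"
  shows "card D \<le> max_code_size F (card W) d"
proof -
  let ?I = "{1..card W}"
  obtain h where h: "bij_betw h ?I W"
    using ex_bij_betw_nat_finite_1[OF assms(2)] by blast
  define \<phi> where "\<phi> x = restrict (x \<circ> h) ?I" for x :: "nat \<Rightarrow> 'a"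
  have dist: "hamming_dist ?I (\<phi> x) (\<phi> y) = hamming_dist W x y" for x y
  proof -
    \<comment> \<open>\<open>h\<close> carries the positions where the relabelled words differ
      exactly onto those where \<open>x\<close> and \<open>y\<close> differ.\<close>
    have "h ` {i \<in> ?I. \<phi> x i \<noteq> \<phi> y i} = {i \<in> W. x i \<noteq> y i}"
      using h by (force simp: \<phi>_def bij_betw_def image_iff)
    moreover have "inj_on h {i \<in> ?I. \<phi> x i \<noteq> \<phi> y i}"
      using h by (auto simp: bij_betw_def intro: inj_on_subset)
    ultimately show ?thesis
      unfolding hamming_dist_def using card_image by fastforce
  qed
  have "inj_on \<phi> D"
  proof (rule inj_onI)
    fix x y assume xy: "x \<in> D" "y \<in> D" "\<phi> x = \<phi> y"
    have "x w = y w" if "w \<in> W" for w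
    proof -
      obtain i where i: "i \<in> ?I" "w = h i"
        using h \<open>w \<in> W\<close> unfolding bij_betw_def by blast
      then show ?thesis
        using fun_cong[OF xy(3), of i] by (simp add: \<phi>_def)
    qed
    then show "x = y"
      using xy(1,2) assms(3) unfolding vectors_def by (meson PiE_ext subsetD)
  qed
  then have "card D = card (\<phi> ` D)"
    by (simp add: card_image)
  also have "\<dots> \<le> max_code_size F (card W) d"
  proof (rule card_le_max_code_size_interval[OF assms(1)])
    show "\<phi> ` D \<subseteq> vectors F ?I"
      using assms(3) bij_betwE[OF h] by (fastforce simp: vectors_def \<phi>_def)
    show "has_distance ?I (\<phi> ` D) d"
      using assms(4) by (auto simp: has_distance_def dist simp del: One_nat_def)
  qed
  finally show ?thesis .
qed

lemma independent_set_imp_induces_acyclic: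
  assumes "independent_set G U"
  shows "induces_acyclic G U"
proof -
  have "edges G \<inter> U \<times> U = {}"
    using assms by (auto simp: independent_set_def)
  then show ?thesis
    using assms by (simp add: induces_acyclic_def independent_set_def acyclic_def)
qed

text \<open>Reduces the undirected case to acyclicity: an independent set induces no edges at
  all.\<close>

lemma admissible_imp_induces_acyclic:
  "U \<in> admissible_sets G \<Longrightarrow> induces_acyclic G U"
  by (auto simp: admissible_sets_def independent_set_imp_induces_acyclic split: if_splits)

text \<open>Guarantees that the minimum in the theorem is taken over a nonempty family.\<close>

lemma empty_admissible: "{} \<in> admissible_sets G"
  by (simp add: admissible_sets_def induces_acyclic_def independent_set_def acyclic_def)

lemma rdss_code_agree_on_acyclic:
  assumes code: "rdss_code F G C" and ac: "induces_acyclic G U"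
    and x: "x \<in> C" and y: "y \<in> C"
    and agree: "\<And>w. w \<in> set_nbrs G U \<Longrightarrow> x w = y w"
    and u: "u \<in> U"
  shows "x u = y u"
proof -
  have UV: "U \<subseteq> vertices G" and "acyclic (edges G \<inter> U \<times> U)"
    using ac by (auto simp: induces_acyclic_def)
  moreover have "finite (edges G \<inter> U \<times> U)"
    using finite_subset[OF UV finite_vertices] by simp
  \<comment> \<open>The converse relation is taken so that the induction hypothesis at
    \<open>u\<close> covers the out-neighbours of \<open>u\<close> in \<open>U\<close>, whose values
    determine the symbol at \<open>u\<close>.\<close>
  ultimately have wf: "wf ((edges G \<inter> U \<times> U)\<inverse>)"
    by (simp add: finite_acyclic_wf_converse)
  obtain f where "\<forall>X\<in>C. \<forall>i\<in>vertices G. X i = f i (restrict X (nbrs G i))"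
    using code unfolding rdss_code_def by blast
  then have f: "X i = f i (restrict X (nbrs G i))" if "X \<in> C" "i \<in> vertices G" for X i
    using that by blast
  have "u \<in> U \<longrightarrow> x u = y u" for u
  proof (induction u rule: wf_induct_rule[OF wf])
    case (1 u)
    show ?case
    proof
      assume u: "u \<in> U"
      \<comment> \<open>An out-neighbour of \<open>u\<close> lies either in \<open>U\<close>, where
        the induction hypothesis applies, or in \<open>set_nbrs G U\<close>, where agreement is
        assumed.\<close>
      have "x w = y w" if "w \<in> nbrs G u" for w
        using that u 1 agree by (cases "w \<in> U") (auto simp: nbrs_def set_nbrs_def)
      then have "restrict x (nbrs G u) = restrict y (nbrs G u)"
        by (auto simp: restrict_def)
      then show "x u = y u"
        using f[OF x, of u] f[OF y, of u] u UV by auto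
    qed
  qed
  with u show ?thesis
    by blast
qed

text \<open>The bound before taking logarithms: the code is split into the fibres \<open>B z\<close>
  of its projection onto \<open>set_nbrs G U\<close>, and each fibre is punctured to the coordinates
  \<open>W\<close>.\<close>

lemma card_rdss_code_le:
  assumes fin: "finite (carrier F)" and code: "rdss_code F G C"
    and dist: "has_distance (vertices G) C d" and ac: "induces_acyclic G U"
  shows "card C \<le> card (carrier F) ^ card (set_nbrs G U) *
           max_code_size F (card (vertices G) - card (U \<union> set_nbrs G U)) d"
proof -
  let ?V = "vertices G" and ?N = "set_nbrs G U"
  define W where "W = ?V - (U \<union> ?N)"
  have UNV: "U \<union> ?N \<subseteq> ?V"
    using ac set_nbrs_subset by (auto simp: induces_acyclic_def)
  have cardW: "card W = card ?V - card (U \<union> ?N)"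
    unfolding W_def using UNV by (meson card_Diff_subset finite_subset finite_vertices)
  have finN: "finite ?N"
    using set_nbrs_subset finite_vertices by (rule finite_subset)
  have CV: "C \<subseteq> vectors F ?V"
    using code by (simp add: rdss_code_def)
  define B where "B z = {x \<in> C. restrict x ?N = z}" for z
  have fibre: "card (B z) \<le> max_code_size F (card W) d" for z
  proof -
    \<comment> \<open>Within a fibre all disagreements lie in \<open>W\<close>. This yields both the
      injectivity of the restriction to \<open>W\<close> and the preservation of distance.\<close>
    have diff: "{i \<in> ?V. x i \<noteq> y i} = {i \<in> W. x i \<noteq> y i}" if "x \<in> B z" "y \<in> B z" for x y
    proof -
      have "x w = y w" if "w \<in> ?N" for w
      proof -
        have "restrict x ?N w = restrict y ?N w"
          using \<open>x \<in> B z\<close> \<open>y \<in> B z\<close> by (simp add: B_def)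
        with that show ?thesis
          by simp
      qed
      moreover from this have "x u = y u" if "u \<in> U" for u
        using rdss_code_agree_on_acyclic[OF code ac, of x y u] \<open>x \<in> B z\<close> \<open>y \<in> B z\<close> that
        by (simp add: B_def)
      ultimately show ?thesis
        by (auto simp: W_def)
    qed
    have restr: "{i \<in> W. restrict x W i \<noteq> restrict y W i} = {i \<in> W. x i \<noteq> y i}" for x y :: "nat \<Rightarrow> 'a"
      by auto
    \<comment> \<open>Injectivity comes from \<open>diff\<close> and not from the distance, so
      \<open>d = 0\<close> is covered too.\<close>
    have "inj_on (\<lambda>x. restrict x W) (B z)"
    proof (rule inj_onI)
      fix x y assume xy: "x \<in> B z" "y \<in> B z" "restrict x W = restrict y W"
      then have "{i \<in> ?V. x i \<noteq> y i} = {}"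
        using diff[of x y] restr[of x y] by simp
      moreover have "x \<in> vectors F ?V" "y \<in> vectors F ?V"
        using xy CV by (auto simp: B_def)
      ultimately show "x = y"
        unfolding vectors_def by (auto intro!: PiE_ext[of x ?V])
    qed
    then have "card (B z) = card ((\<lambda>x. restrict x W) ` B z)"
      by (simp add: card_image)
    also have "\<dots> \<le> max_code_size F (card W) d"
    proof (rule card_le_max_code_size[OF fin])
      show "finite W"
        by (simp add: W_def finite_vertices)
      have "W \<subseteq> ?V"
        by (simp add: W_def)
      then show "(\<lambda>x. restrict x W) ` B z \<subseteq> vectors F W"
        using CV restrict_in_vectors by (fastforce simp: B_def)
      show "has_distance W ((\<lambda>x. restrict x W) ` B z) d"
        unfolding has_distance_def
      proof (clarify)
        fix x y assume xy: "x \<in> B z" "y \<in> B z" "restrict x W \<noteq> restrict y W"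
        then have "d \<le> hamming_dist ?V x y"
          using dist by (auto simp: has_distance_def B_def)
        then show "d \<le> hamming_dist W (restrict x W) (restrict y W)"
          unfolding hamming_dist_def restr diff[OF xy(1,2)] .
      qed
    qed
    finally show ?thesis .
  qed
  have "restrict x ?N \<in> vectors F ?N" if "x \<in> C" for x
    using CV that set_nbrs_subset by (blast intro: restrict_in_vectors)
  \<comment> \<open>The index \<open>z\<close> runs over all words on \<open>?N\<close>; fibres over
    words that do not occur are empty.\<close>
  then have "C = (\<Union>z\<in>vectors F ?N. B z)"
    by (auto simp: B_def)
  then have "card C \<le> (\<Sum>z\<in>vectors F ?N. card (B z))"
    using card_UN_le[OF finite_vectors[OF fin finN]] by metis
  also have "\<dots> \<le> card (vectors F ?N) * max_code_size F (card W) d"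
    using sum_bounded_above[of "vectors F ?N", OF fibre] by simp
  finally show ?thesis
    by (simp add: card_vectors finN cardW)
qed

theorem proposition15:
  fixes q d :: nat and k :: real
    and F :: "('a, 'b) ring_scheme"
    and G :: dss_graph
    and C :: "(nat \<Rightarrow> 'a) set"
  assumes "primepow q"
    and "field F" and "card (carrier F) = q"
    and "wf_graph G"
    and "rdss_code F G C"
    and "has_distance (vertices G) C d"
    and "k = code_dimension F C"
  shows "k \<le> Min ((\<lambda>U. real (card (set_nbrs G U)) +
                 log (real q) (real (max_code_size F
                   (card (vertices G) - card (U \<union> set_nbrs G U)) d)))
               ` admissible_sets G)"
proof -
  have q: "q > 1"
    using primepow_gt_Suc_0[OF assms(1)] by simp
  \<comment> \<open>An infinite set has \<open>card\<close> equal to 0, so \<open>q > 1\<close>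
    forces the carrier to be finite.\<close>
  have fin: "finite (carrier F)" and ne: "carrier F \<noteq> {}"
    using q assms(3) by (auto intro: card_ge_0_finite)
  have "C \<noteq> {}" "finite C"
    using assms(5) finite_subset[OF _ finite_vectors[OF fin finite_vertices]]
    by (auto simp: rdss_code_def)
  then have C: "0 < card C"
    by (simp add: card_gt_0_iff)
  have "admissible_sets G \<subseteq> Pow (vertices G)"
    using admissible_imp_induces_acyclic by (auto simp: induces_acyclic_def)
  then have fin_adm: "finite (admissible_sets G)"
    by (rule finite_subset) (simp add: finite_vertices)
  have "k \<le> real (card (set_nbrs G U)) + log (real q) (real (max_code_size F
               (card (vertices G) - card (U \<union> set_nbrs G U)) d))"
    if "U \<in> admissible_sets G" for U
  proof -
    define A where "A = max_code_size F (card (vertices G) - card (U \<union> set_nbrs G U)) d"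
    have A: "0 < A"
      unfolding A_def using fin ne by (rule max_code_size_pos)
    have "card C \<le> q ^ card (set_nbrs G U) * A"
      using card_rdss_code_le[OF fin assms(5,6) admissible_imp_induces_acyclic[OF that]]
      by (simp add: A_def assms(3))
    then have "real (card C) \<le> real q ^ card (set_nbrs G U) * real A"
      by (metis of_nat_le_iff of_nat_mult of_nat_power)
    \<comment> \<open>Monotonicity of the logarithm uses base \<open>q > 1\<close> and a nonempty
      finite code.\<close>
    then have "k \<le> log (real q) (real q ^ card (set_nbrs G U) * real A)"
      using q C by (simp add: assms(3,7) code_dimension_def)
    also have "\<dots> = real (card (set_nbrs G U)) + log (real q) (real A)"
      using q A by (simp add: log_mult log_nat_power)
    finally show ?thesis
      by (simp add: A_def)
  qed
  then show ?thesis
    using fin_adm empty_admissible by (subst Min_ge_iff) auto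
qed

end
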